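(* Let $V$ be a finite-dimensional double algebra over a field $\Bbbk$ whose double bracket $\{\!\{\cdot,\cdot\}\!\}$ is determined by the linear operator $R:\mathrm{End}\,V\to\mathrm{End}\,V$, and let $R^*$ be the conjugate of $R$ relative to the trace form. Then: (1) $V$ is a Lie double algebra if and only if $R^*=-R$ and $R(x)R(y)=R(R(x)y)+R(xR(y))$ for all $x,y\in\mathrm{End}\,V$. (2) $V$ is an associative double algebra if and only if $R(x)R(y)=R(R(x)y)$ and $R^*(x)R^*(y)=R^*(R^*(x)y)$ for all $x,y\in\mathrm{End}\,V$. (3) $V$ is a commutative double algebra if and only if $R=R^*$ and $R(x)R(y)=R(R(x)y)=R(xR(y))$ for all $x,y\in\mathrm{End}\,V$.
   Context: A double algebra over a field $\Bbbk$ is a linear space $V$ with a linear map (double bracket) $V\otimes V\to V\otimes V$, $a\otimes b\mapsto \{\!\{a,b\}\!\}$. For $u\in V^{\otimes n}$ and $\sigma\in S_n$, $u^\sigma$ denotes the result of permuting the tensor factors of $u$ by $\sigma$ (e.g. $u^{(12)}$ interchanges the first two factors). The double bracket is extended linearly to four maps $V^{\otimes 3}\to V^{\otimes 3}$ by $\{\!\{a,b\otimes c\}\!\}_L=\{\!\{a,b\}\!\}\otimes c$, $\{\!\{a,b\otimes c\}\!\}_R=(b\otimes\{\!\{a,c\}\!\})^{(12)}$, $\{\!\{a\otimes b,c\}\!\}_L=(\{\!\{a,c\}\!\}\otimes b)^{(23)}$, $\{\!\{a\otimes b,c\}\!\}_R=a\otimes\{\!\{b,c\}\!\}$. $V$ is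 a Lie double algebra if for all $a,b,c\in V$: $\{\!\{a,b\}\!\}=-\{\!\{b,a\}\!\}^{(12)}$ and $\{\!\{a,\{\!\{b,c\}\!\}\}\!\}_L-\{\!\{b,\{\!\{a,c\}\!\}\}\!\}_R^{(12)}=\{\!\{\{\!\{a,b\}\!\},c\}\!\}_L$. $V$ is associative if for all $a,b,c\in V$: $\{\!\{a,\{\!\{b,c\}\!\}\}\!\}_L=\{\!\{\{\!\{a,b\}\!\},c\}\!\}_L$ and $\{\!\{a,\{\!\{b,c\}\!\}\}\!\}_R=\{\!\{\{\!\{a,b\}\!\},c\}\!\}_R$. $V$ is commutative if it is associative and $\{\!\{a,b\}\!\}=\{\!\{b,a\}\!\}^{(12)}$ for all $a,b\in V$. For finite-dimensional $V$, $\mathrm{End}\,V$ is the algebra of linear transformations of $V$ with the trace form $\langle x,y\rangle=\mathrm{tr}(xy)$. For a linear operator $R$ on $\mathrm{End}\,V$, the conjugate $R^*$ is defined by $\langle R(x),y\rangle=\langle x,R^*(y)\rangle$. Every double bracket on $V$ is determined by a unique linear operator $R:\mathrm{End}\,V\to\mathrm{End}\,V$ via $$\{\!\{a,b\}\!\}=\sum_{i=1}^N e_i(a)\otimes R(e_i^* )(b)=\sum_{i=1}^N R^*(e_i)(a)\otimes e_i^*(b),\quad a,b\in V,$$ where $e_1,\dots,e_N$ is any linear basis of $\mathrm{End}\,V$ and $e_1^*,\dots,e_N^*$ is the dual basis relative to the trace form. *)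

theory Defs
  imports Complex_Main "HOL-Library.Function_Algebras"
begin

section \<open>Linear algebra on function spaces\<close>

text \<open>Function types carry the pointwise addition of \<^theory>\<open>HOL-Library.Function_Algebras\<close>
  and the pointwise scalar multiplication below. The vector space \<open>V\<close> is a type \<open>'v\<close> with scalar
  multiplication \<open>s\<close>, subject to the library locale \<^locale>\<open>vector_space\<close> or
  \<^locale>\<open>finite_dimensional_vector_space\<close>.\<close>

definition fun_scale :: "('k \<Rightarrow> 'w \<Rightarrow> 'w) \<Rightarrow> 'k \<Rightarrow> ('x \<Rightarrow> 'w) \<Rightarrow> ('x \<Rightarrow> 'w)"
  where "fun_scale s c f = (\<lambda>x. s c (f x))"

text \<open>Linearity of a map between subspaces; its values outside \<open>U\<close> are irrelevant.\<close>

definition linear_between ::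
  "('k \<Rightarrow> 'u \<Rightarrow> 'u) \<Rightarrow> ('u::ab_group_add) set \<Rightarrow> ('k \<Rightarrow> 'w \<Rightarrow> 'w) \<Rightarrow> ('w::ab_group_add) set
    \<Rightarrow> ('u \<Rightarrow> 'w) \<Rightarrow> bool"
  where "linear_between s1 U s2 W f \<longleftrightarrow>
    (\<forall>x\<in>U. f x \<in> W) \<and>
    (\<forall>x\<in>U. \<forall>y\<in>U. f (x + y) = f x + f y) \<and>
    (\<forall>c. \<forall>x\<in>U. f (s1 c x) = s2 c (f x))"

definition bilinear_map ::
  "('k \<Rightarrow> 'v \<Rightarrow> 'v) \<Rightarrow> ('k \<Rightarrow> 'w \<Rightarrow> 'w) \<Rightarrow> ('v::ab_group_add \<Rightarrow> 'v \<Rightarrow> 'w::ab_group_add) \<Rightarrow> bool"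
  where "bilinear_map s sw F \<longleftrightarrow>
    (\<forall>b. linear_between s UNIV sw UNIV (\<lambda>a. F a b)) \<and>
    (\<forall>a. linear_between s UNIV sw UNIV (F a))"

definition trilinear_map ::
  "('k \<Rightarrow> 'v \<Rightarrow> 'v) \<Rightarrow> ('k \<Rightarrow> 'w \<Rightarrow> 'w) \<Rightarrow> ('v::ab_group_add \<Rightarrow> 'v \<Rightarrow> 'v \<Rightarrow> 'w::ab_group_add) \<Rightarrow> bool"
  where "trilinear_map s sw F \<longleftrightarrow>
    (\<forall>b c. linear_between s UNIV sw UNIV (\<lambda>a. F a b c)) \<and>
    (\<forall>a c. linear_between s UNIV sw UNIV (\<lambda>b. F a b c)) \<and>
    (\<forall>a b. linear_between s UNIV sw UNIV (F a b))"


section \<open>Tensor powers\<close>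

text \<open>Tensors are modelled as multilinear forms on linear functionals:
  \<open>(a \<otimes> b)(f, g) = f(a) g(b)\<close>, and \<open>V \<otimes> V\<close> is the linear span of the pure tensors. The guard
  makes tensors vanish on arguments that are not linear functionals, so that \<open>a \<otimes> b\<close> is bilinear
  in \<open>a\<close> and \<open>b\<close>. The universal properties are proved in \<open>tensor2_universal\<close>,
  \<open>tensor2_unique\<close>, \<open>tensor3_universal\<close> and \<open>tensor3_unique\<close> below.\<close>

type_synonym ('k, 'v) tensor2 = "('v \<Rightarrow> 'k) \<Rightarrow> ('v \<Rightarrow> 'k) \<Rightarrow> 'k"
type_synonym ('k, 'v) tensor3 = "('v \<Rightarrow> 'k) \<Rightarrow> ('v \<Rightarrow> 'k) \<Rightarrow> ('v \<Rightarrow> 'k) \<Rightarrow> 'k"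

definition functional :: "('k::field \<Rightarrow> 'v::ab_group_add \<Rightarrow> 'v) \<Rightarrow> ('v \<Rightarrow> 'k) \<Rightarrow> bool"
  where "functional s f \<longleftrightarrow> Vector_Spaces.linear s (*) f"

definition scale2 :: "'k::field \<Rightarrow> ('k, 'v) tensor2 \<Rightarrow> ('k, 'v) tensor2"
  where "scale2 = fun_scale (fun_scale (*))"

definition scale3 :: "'k::field \<Rightarrow> ('k, 'v) tensor3 \<Rightarrow> ('k, 'v) tensor3"
  where "scale3 = fun_scale (fun_scale (fun_scale (*)))"

definition ev :: "('k::field \<Rightarrow> 'v::ab_group_add \<Rightarrow> 'v) \<Rightarrow> 'v \<Rightarrow> ('v \<Rightarrow> 'k) \<Rightarrow> 'k"
  where "ev s a f = (if functional s f then f a else 0)"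

definition tens :: "('k::field \<Rightarrow> 'v::ab_group_add \<Rightarrow> 'v) \<Rightarrow> 'v \<Rightarrow> 'v \<Rightarrow> ('k, 'v) tensor2"
  where "tens s a b = (\<lambda>f g. ev s a f * ev s b g)"

definition tens3 :: "('k::field \<Rightarrow> 'v::ab_group_add \<Rightarrow> 'v) \<Rightarrow> 'v \<Rightarrow> 'v \<Rightarrow> 'v \<Rightarrow> ('k, 'v) tensor3"
  where "tens3 s a b c = (\<lambda>f g h. ev s a f * ev s b g * ev s c h)"

definition tensor_square :: "('k::field \<Rightarrow> 'v::ab_group_add \<Rightarrow> 'v) \<Rightarrow> ('k, 'v) tensor2 set"
  where "tensor_square s = module.span scale2 {tens s a b | a b. True}"

definition tensor_cube :: "('k::field \<Rightarrow> 'v::ab_group_add \<Rightarrow> 'v) \<Rightarrow> ('k, 'v) tensor3 set"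
  where "tensor_cube s = module.span scale3 {tens3 s a b c | a b c. True}"

text \<open>\<open>u \<otimes> c\<close> and \<open>a \<otimes> u\<close> for \<open>u\<close> in \<open>V \<otimes> V\<close>.\<close>

definition tens_right ::
  "('k::field \<Rightarrow> 'v::ab_group_add \<Rightarrow> 'v) \<Rightarrow> ('k, 'v) tensor2 \<Rightarrow> 'v \<Rightarrow> ('k, 'v) tensor3"
  where "tens_right s u c = (\<lambda>f g h. u f g * ev s c h)"

definition tens_left ::
  "('k::field \<Rightarrow> 'v::ab_group_add \<Rightarrow> 'v) \<Rightarrow> 'v \<Rightarrow> ('k, 'v) tensor2 \<Rightarrow> ('k, 'v) tensor3"
  where "tens_left s a u = (\<lambda>f g h. ev s a f * u g h)"

definition swap2 :: "('k, 'v) tensor2 \<Rightarrow> ('k, 'v) tensor2"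
  where "swap2 u = (\<lambda>f g. u g f)"

definition perm12 :: "('k, 'v) tensor3 \<Rightarrow> ('k, 'v) tensor3"
  where "perm12 u = (\<lambda>f g h. u g f h)"

definition perm23 :: "('k, 'v) tensor3 \<Rightarrow> ('k, 'v) tensor3"
  where "perm23 u = (\<lambda>f g h. u f h g)"

text \<open>The linear map on \<open>V \<otimes> V\<close> with value \<open>F a b\<close> at \<open>a \<otimes> b\<close>, for bilinear \<open>F\<close>; existence and
  uniqueness on \<open>V \<otimes> V\<close> are \<open>lin_ext_tens\<close>, \<open>lin_ext_linear\<close> and \<open>tensor2_unique\<close>.\<close>

definition lin_ext ::
  "('k::field \<Rightarrow> 'v::ab_group_add \<Rightarrow> 'v) \<Rightarrow> ('k \<Rightarrow> 'w \<Rightarrow> 'w) \<Rightarrow> ('v \<Rightarrow> 'v \<Rightarrow> 'w::ab_group_add)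
    \<Rightarrow> ('k, 'v) tensor2 \<Rightarrow> 'w"
  where "lin_ext s sw F = (SOME G. linear_between scale2 (tensor_square s) sw UNIV G \<and>
    (\<forall>a b. G (tens s a b) = F a b))"


section \<open>Double algebras\<close>

definition double_bracket ::
  "('k::field \<Rightarrow> 'v::ab_group_add \<Rightarrow> 'v) \<Rightarrow> (('k, 'v) tensor2 \<Rightarrow> ('k, 'v) tensor2) \<Rightarrow> bool"
  where "double_bracket s D \<longleftrightarrow>
    linear_between scale2 (tensor_square s) scale2 (tensor_square s) D"

definition br ::
  "('k::field \<Rightarrow> 'v::ab_group_add \<Rightarrow> 'v) \<Rightarrow> (('k, 'v) tensor2 \<Rightarrow> ('k, 'v) tensor2)
    \<Rightarrow> 'v \<Rightarrow> 'v \<Rightarrow> ('k, 'v) tensor2"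
  where "br s D a b = D (tens s a b)"

text \<open>The four extended brackets: \<open>br_VT_L s D a u\<close> is \<open>{{a, u}}\<^sub>L\<close> and \<open>br_TV_L s D u c\<close> is
  \<open>{{u, c}}\<^sub>L\<close> for \<open>u\<close> in \<open>V \<otimes> V\<close>; similarly for \<open>R\<close>.\<close>

definition br_VT_L ::
  "('k::field \<Rightarrow> 'v::ab_group_add \<Rightarrow> 'v) \<Rightarrow> (('k, 'v) tensor2 \<Rightarrow> ('k, 'v) tensor2)
    \<Rightarrow> 'v \<Rightarrow> ('k, 'v) tensor2 \<Rightarrow> ('k, 'v) tensor3"
  where "br_VT_L s D a = lin_ext s scale3 (\<lambda>b c. tens_right s (br s D a b) c)"

definition br_VT_R ::
  "('k::field \<Rightarrow> 'v::ab_group_add \<Rightarrow> 'v) \<Rightarrow> (('k, 'v) tensor2 \<Rightarrow> ('k, 'v) tensor2)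
    \<Rightarrow> 'v \<Rightarrow> ('k, 'v) tensor2 \<Rightarrow> ('k, 'v) tensor3"
  where "br_VT_R s D a = lin_ext s scale3 (\<lambda>b c. perm12 (tens_left s b (br s D a c)))"

definition br_TV_L ::
  "('k::field \<Rightarrow> 'v::ab_group_add \<Rightarrow> 'v) \<Rightarrow> (('k, 'v) tensor2 \<Rightarrow> ('k, 'v) tensor2)
    \<Rightarrow> ('k, 'v) tensor2 \<Rightarrow> 'v \<Rightarrow> ('k, 'v) tensor3"
  where "br_TV_L s D u c = lin_ext s scale3 (\<lambda>a b. perm23 (tens_right s (br s D a c) b)) u"

definition br_TV_R ::
  "('k::field \<Rightarrow> 'v::ab_group_add \<Rightarrow> 'v) \<Rightarrow> (('k, 'v) tensor2 \<Rightarrow> ('k, 'v) tensor2)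
    \<Rightarrow> ('k, 'v) tensor2 \<Rightarrow> 'v \<Rightarrow> ('k, 'v) tensor3"
  where "br_TV_R s D u c = lin_ext s scale3 (\<lambda>a b. tens_left s a (br s D b c)) u"

definition lie_double_algebra ::
  "('k::field \<Rightarrow> 'v::ab_group_add \<Rightarrow> 'v) \<Rightarrow> (('k, 'v) tensor2 \<Rightarrow> ('k, 'v) tensor2) \<Rightarrow> bool"
  where "lie_double_algebra s D \<longleftrightarrow> double_bracket s D \<and>
    (\<forall>a b. br s D a b = - swap2 (br s D b a)) \<and>
    (\<forall>a b c. br_VT_L s D a (br s D b c) - perm12 (br_VT_R s D b (br s D a c))
      = br_TV_L s D (br s D a b) c)"

definition assoc_double_algebra ::
  "('k::field \<Rightarrow> 'v::ab_group_add \<Rightarrow> 'v) \<Rightarrow> (('k, 'v) tensor2 \<Rightarrow> ('k, 'v) tensor2) \<Rightarrow> bool"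
  where "assoc_double_algebra s D \<longleftrightarrow> double_bracket s D \<and>
    (\<forall>a b c. br_VT_L s D a (br s D b c) = br_TV_L s D (br s D a b) c) \<and>
    (\<forall>a b c. br_VT_R s D a (br s D b c) = br_TV_R s D (br s D a b) c)"

definition comm_double_algebra ::
  "('k::field \<Rightarrow> 'v::ab_group_add \<Rightarrow> 'v) \<Rightarrow> (('k, 'v) tensor2 \<Rightarrow> ('k, 'v) tensor2) \<Rightarrow> bool"
  where "comm_double_algebra s D \<longleftrightarrow> assoc_double_algebra s D \<and>
    (\<forall>a b. br s D a b = swap2 (br s D b a))"


section \<open>Endomorphisms and the trace form\<close>

definition End_space :: "('k::field \<Rightarrow> 'v::ab_group_add \<Rightarrow> 'v) \<Rightarrow> ('v \<Rightarrow> 'v) set"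
  where "End_space s = {x. Vector_Spaces.linear s s x}"

text \<open>The trace computed in the basis \<open>B\<close>; it does not depend on \<open>B\<close>, see
  \<open>endo_trace_basis_independent\<close>.\<close>

definition endo_trace ::
  "('k::field \<Rightarrow> 'v::ab_group_add \<Rightarrow> 'v) \<Rightarrow> 'v set \<Rightarrow> ('v \<Rightarrow> 'v) \<Rightarrow> 'k"
  where "endo_trace s B x = (\<Sum>b\<in>B. module.representation s B (x b) b)"

definition trace_form ::
  "('k::field \<Rightarrow> 'v::ab_group_add \<Rightarrow> 'v) \<Rightarrow> 'v set \<Rightarrow> ('v \<Rightarrow> 'v) \<Rightarrow> ('v \<Rightarrow> 'v) \<Rightarrow> 'k"
  where "trace_form s B x y = endo_trace s B (x \<circ> y)"

definition End_operator ::
  "('k::field \<Rightarrow> 'v::ab_group_add \<Rightarrow> 'v) \<Rightarrow> (('v \<Rightarrow> 'v) \<Rightarrow> ('v \<Rightarrow> 'v)) \<Rightarrow> bool"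
  where "End_operator s R \<longleftrightarrow>
    linear_between (fun_scale s) (End_space s) (fun_scale s) (End_space s) R"

definition conjugate_operator ::
  "('k::field \<Rightarrow> 'v::ab_group_add \<Rightarrow> 'v) \<Rightarrow> 'v set
    \<Rightarrow> (('v \<Rightarrow> 'v) \<Rightarrow> ('v \<Rightarrow> 'v)) \<Rightarrow> (('v \<Rightarrow> 'v) \<Rightarrow> ('v \<Rightarrow> 'v)) \<Rightarrow> bool"
  where "conjugate_operator s B R R' \<longleftrightarrow> End_operator s R' \<and>
    (\<forall>x\<in>End_space s. \<forall>y\<in>End_space s. trace_form s B (R x) y = trace_form s B x (R' y))"

definition End_basis ::
  "('k::field \<Rightarrow> 'v::ab_group_add \<Rightarrow> 'v) \<Rightarrow> nat \<Rightarrow> (nat \<Rightarrow> 'v \<Rightarrow> 'v) \<Rightarrow> bool"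
  where "End_basis s N e \<longleftrightarrow> inj_on e {1..N} \<and>
    \<not> module.dependent (fun_scale s) (e ` {1..N}) \<and>
    module.span (fun_scale s) (e ` {1..N}) = End_space s"

definition dual_End_basis ::
  "('k::field \<Rightarrow> 'v::ab_group_add \<Rightarrow> 'v) \<Rightarrow> 'v set \<Rightarrow> nat
    \<Rightarrow> (nat \<Rightarrow> 'v \<Rightarrow> 'v) \<Rightarrow> (nat \<Rightarrow> 'v \<Rightarrow> 'v) \<Rightarrow> bool"
  where "dual_End_basis s B N e e' \<longleftrightarrow> End_basis s N e' \<and>
    (\<forall>i\<in>{1..N}. \<forall>j\<in>{1..N}. trace_form s B (e i) (e' j) = (if i = j then 1 else 0))"

text \<open>The operator \<open>R\<close> determines the bracket \<open>D\<close> through the basis \<open>e\<close> and its dual \<open>e'\<close>.\<close>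

definition bracket_of_operator ::
  "('k::field \<Rightarrow> 'v::ab_group_add \<Rightarrow> 'v) \<Rightarrow> nat \<Rightarrow> (nat \<Rightarrow> 'v \<Rightarrow> 'v) \<Rightarrow> (nat \<Rightarrow> 'v \<Rightarrow> 'v)
    \<Rightarrow> (('v \<Rightarrow> 'v) \<Rightarrow> ('v \<Rightarrow> 'v)) \<Rightarrow> (('k, 'v) tensor2 \<Rightarrow> ('k, 'v) tensor2) \<Rightarrow> bool"
  where "bracket_of_operator s N e e' R D \<longleftrightarrow>
    (\<forall>a b. br s D a b = (\<Sum>i=1..N. tens s (e i a) (R (e' i) b)))"


section \<open>The tensor model is a tensor product\<close>

lemma vector_space_fun_scale:
  assumes "vector_space s" shows "vector_space (fun_scale s)"
proof -
  interpret vector_space s by fact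
  show ?thesis
    by unfold_locales (auto simp: fun_scale_def fun_eq_iff scale_right_distrib scale_left_distrib)
qed

lemma vector_space_mult: "vector_space ((*) :: 'k::field \<Rightarrow> 'k \<Rightarrow> 'k)"
  by unfold_locales (auto simp: algebra_simps)

lemma vector_space_scale2: "vector_space scale2"
  unfolding scale2_def by (intro vector_space_fun_scale vector_space_mult)

lemma vector_space_scale3: "vector_space scale3"
  unfolding scale3_def by (intro vector_space_fun_scale vector_space_mult)

lemma functional_add: "functional s f \<Longrightarrow> f (x + y) = f x + f y"
  unfolding functional_def using module_hom.add[of s "(*)" f] by (simp add: Vector_Spaces.linear_def)

lemma functional_scale: "functional s f \<Longrightarrow> f (s c x) = c * f x"
  unfolding functional_def using module_hom.scale[of s "(*)" f] by (simp add: Vector_Spaces.linear_def)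

lemma ev_add: "ev s (x + y) f = ev s x f + ev s y f"
  by (simp add: ev_def functional_add)

lemma ev_scale: "ev s (s c x) f = c * ev s x f"
  by (simp add: ev_def functional_scale)

lemma bilinear_tens: "bilinear_map s scale2 (tens s)"
  by (auto simp: bilinear_map_def linear_between_def tens_def scale2_def fun_scale_def fun_eq_iff
      ev_add ev_scale algebra_simps)

lemma trilinear_tens3: "trilinear_map s scale3 (tens3 s)"
  by (auto simp: trilinear_map_def linear_between_def tens3_def scale3_def fun_scale_def fun_eq_iff
      ev_add ev_scale algebra_simps)

lemma tens_right_tens: "tens_right s (tens s a b) c = tens3 s a b c"
  by (simp add: tens_right_def tens_def tens3_def)

lemma tens_left_tens: "tens_left s a (tens s b c) = tens3 s a b c"
  by (simp add: tens_left_def tens_def tens3_def mult.assoc)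

lemma swap2_tens: "swap2 (tens s a b) = tens s b a"
  by (simp add: swap2_def tens_def mult.commute)

lemma perm12_tens3: "perm12 (tens3 s a b c) = tens3 s b a c"
  by (simp add: perm12_def tens3_def mult_ac)

lemma perm23_tens3: "perm23 (tens3 s a b c) = tens3 s a c b"
  by (simp add: perm23_def tens3_def mult_ac)

lemma linear_between_eq_on_span:
  assumes "vector_space s1" "vector_space s2"
    and G: "linear_between s1 (module.span s1 S) s2 UNIV G"
    and H: "linear_between s1 (module.span s1 S) s2 UNIV H"
    and eq: "\<And>x. x \<in> S \<Longrightarrow> G x = H x" and u: "u \<in> module.span s1 S"
  shows "G u = H u"
proof -
  interpret v1: vector_space s1 by fact
  interpret v2: vector_space s2 by fact
  have "u \<in> v1.span S \<and> G u = H u"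
    using u
  proof (induction rule: v1.span_induct_alt)
    case base
    have "G (s1 0 0) = s2 0 (G 0)" "H (s1 0 0) = s2 0 (H 0)"
      using G H v1.span_zero unfolding linear_between_def by blast+
    then show ?case by (simp add: v1.span_zero)
  next
    case (step c x y)
    then have "x \<in> v1.span S" "s1 c x \<in> v1.span S" by (auto intro: v1.span_base v1.span_scale)
    then show ?case
      using step G H eq unfolding linear_between_def by (auto intro: v1.span_add)
  qed
  then show ?thesis ..
qed

lemma tensor2_unique:
  assumes "vector_space s" "vector_space sw"
    and "linear_between scale2 (tensor_square s) sw UNIV G"
    and "linear_between scale2 (tensor_square s) sw UNIV H"
    and "\<And>a b. G (tens s a b) = H (tens s a b)" and "u \<in> tensor_square s"
  shows "G u = H u"
  using assms linear_between_eq_on_span[OF vector_space_scale2 assms(2)]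
  unfolding tensor_square_def by blast

lemma tensor3_unique:
  assumes "vector_space s" "vector_space sw"
    and "linear_between scale3 (tensor_cube s) sw UNIV G"
    and "linear_between scale3 (tensor_cube s) sw UNIV H"
    and "\<And>a b c. G (tens3 s a b c) = H (tens3 s a b c)" and "u \<in> tensor_cube s"
  shows "G u = H u"
  using assms linear_between_eq_on_span[OF vector_space_scale3 assms(2)]
  unfolding tensor_cube_def by blast

context finite_dimensional_vector_space
begin

definition coord :: "'b \<Rightarrow> 'b \<Rightarrow> 'a"
  where "coord b v = representation Basis v b"

lemma functional_coord: "functional scale (coord b)"
proof -
  interpret vf: vector_space "(*) :: 'a \<Rightarrow> 'a \<Rightarrow> 'a" by (rule vector_space_mult)
  show ?thesis
    unfolding functional_def
    by unfold_locales
      (auto simp: coord_def representation_add representation_scale independent_Basis span_Basis)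
qed

lemma sum_coord: "(\<Sum>b\<in>Basis. scale (coord b v) b) = v"
  unfolding coord_def
  by (rule sum_representation_eq) (auto simp: independent_Basis span_Basis finite_Basis)

lemma ev_coord: "ev scale a (coord b) = coord b a"
  by (simp add: ev_def functional_coord)

lemma sum_coord_linear:
  assumes "vector_space sw" "linear_between scale UNIV sw UNIV f"
  shows "(\<Sum>b\<in>Basis. sw (coord b v) (f b)) = f v"
proof -
  interpret w: vector_space sw by fact
  have add: "f (x + y) = f x + f y" and sc: "f (scale c x) = sw c (f x)" for x y c
    using assms(2) by (auto simp: linear_between_def)
  have f0: "f 0 = 0" using sc[of 0 0] by simp
  have "f (\<Sum>b\<in>A. scale (coord b v) b) = (\<Sum>b\<in>A. sw (coord b v) (f b))" if "finite A" for A
    using that by induction (auto simp: f0 add sc)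
  from this[OF finite_Basis] show ?thesis by (simp add: sum_coord)
qed

lemma tensor2_universal:
  assumes "vector_space sw" "bilinear_map scale sw F"
  shows "\<exists>G. linear_between scale2 (tensor_square scale) sw UNIV G \<and>
    (\<forall>a b. G (tens scale a b) = F a b)"
proof -
  interpret w: vector_space sw by fact
  define G where "G = (\<lambda>T. \<Sum>b\<in>Basis. \<Sum>c\<in>Basis. sw (T (coord b) (coord c)) (F b c))"
  have "linear_between scale2 (tensor_square scale) sw UNIV G"
    by (auto simp: linear_between_def G_def scale2_def fun_scale_def w.scale_left_distrib
        sum.distrib w.scale_sum_right)
  moreover have "G (tens scale x y) = F x y" for x y
  proof -
    have "G (tens scale x y) =
        (\<Sum>b\<in>Basis. sw (coord b x) (\<Sum>c\<in>Basis. sw (coord c y) (F b c)))"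
      by (simp add: G_def tens_def ev_coord w.scale_sum_right)
    also have "\<dots> = (\<Sum>b\<in>Basis. sw (coord b x) (F b y))"
      using assms by (simp add: sum_coord_linear bilinear_map_def)
    also have "\<dots> = F x y"
      using assms by (intro sum_coord_linear) (auto simp: bilinear_map_def)
    finally show ?thesis .
  qed
  ultimately show ?thesis by blast
qed

lemma tensor3_universal:
  assumes "vector_space sw" "trilinear_map scale sw F"
  shows "\<exists>G. linear_between scale3 (tensor_cube scale) sw UNIV G \<and>
    (\<forall>a b c. G (tens3 scale a b c) = F a b c)"
proof -
  interpret w: vector_space sw by fact
  define G where "G = (\<lambda>T. \<Sum>b\<in>Basis. \<Sum>c\<in>Basis. \<Sum>d\<in>Basis.
    sw (T (coord b) (coord c) (coord d)) (F b c d))"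
  have "linear_between scale3 (tensor_cube scale) sw UNIV G"
    by (auto simp: linear_between_def G_def scale3_def fun_scale_def w.scale_left_distrib
        sum.distrib w.scale_sum_right)
  moreover have "G (tens3 scale x y z) = F x y z" for x y z
  proof -
    have "G (tens3 scale x y z) = (\<Sum>b\<in>Basis. sw (coord b x)
        (\<Sum>c\<in>Basis. sw (coord c y) (\<Sum>d\<in>Basis. sw (coord d z) (F b c d))))"
      by (simp add: G_def tens3_def ev_coord w.scale_sum_right mult.assoc)
    also have "\<dots> = (\<Sum>b\<in>Basis. sw (coord b x) (\<Sum>c\<in>Basis. sw (coord c y) (F b c z)))"
      using assms by (simp add: sum_coord_linear trilinear_map_def)
    also have "\<dots> = (\<Sum>b\<in>Basis. sw (coord b x) (F b y z))"
      using assms by (intro sum.cong refl arg_cong2[where f = sw] sum_coord_linear)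
        (auto simp: trilinear_map_def)
    also have "\<dots> = F x y z"
      using assms by (intro sum_coord_linear) (auto simp: trilinear_map_def)
    finally show ?thesis .
  qed
  ultimately show ?thesis by blast
qed

lemma
  assumes "vector_space sw" "bilinear_map scale sw F"
  shows lin_ext_linear:
      "linear_between scale2 (tensor_square scale) sw UNIV (lin_ext scale sw F)"
    and lin_ext_tens: "lin_ext scale sw F (tens scale a b) = F a b"
  using someI_ex[OF tensor2_universal[OF assms]] unfolding lin_ext_def by blast+

lemma bilinear_br:
  assumes "double_bracket scale D" shows "bilinear_map scale scale2 (br scale D)"
proof -
  interpret v2: vector_space "scale2 :: 'a \<Rightarrow> ('a, 'b) tensor2 \<Rightarrow> _" by (rule vector_space_scale2)
  have [simp]: "tens scale x y \<in> tensor_square scale" for x y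
    unfolding tensor_square_def by (rule v2.span_base) auto
  have t: "tens scale (x + y) b = tens scale x b + tens scale y b"
    "tens scale (scale c x) b = scale2 c (tens scale x b)"
    "tens scale b (x + y) = tens scale b x + tens scale b y"
    "tens scale b (scale c x) = scale2 c (tens scale b x)" for x y b c
    using bilinear_tens[of scale] unfolding bilinear_map_def linear_between_def by blast+
  have d1: "D (u + v) = D u + D v" if "u \<in> tensor_square scale" "v \<in> tensor_square scale" for u v
    using assms that unfolding double_bracket_def linear_between_def by blast
  have d2: "D (scale2 c u) = scale2 c (D u)" if "u \<in> tensor_square scale" for u c
    using assms that unfolding double_bracket_def linear_between_def by blast
  show ?thesis
    unfolding bilinear_map_def linear_between_def br_def t
    by (intro conjI allI ballI UNIV_I d1 d2) simp_all
qed

lemma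
  assumes "double_bracket scale D"
  shows br_VT_L_tens: "br_VT_L scale D a (tens scale b c) = tens_right scale (br scale D a b) c"
    and br_VT_R_tens: "br_VT_R scale D a (tens scale b c) = perm12 (tens_left scale b (br scale D a c))"
    and br_TV_L_tens: "br_TV_L scale D (tens scale a b) c = perm23 (tens_right scale (br scale D a c) b)"
    and br_TV_R_tens: "br_TV_R scale D (tens scale a b) c = tens_left scale a (br scale D b c)"
proof -
  note B = bilinear_br[OF assms]
  note defs = bilinear_map_def linear_between_def tens_right_def tens_left_def perm12_def
    perm23_def scale2_def scale3_def fun_scale_def fun_eq_iff ev_add ev_scale
  show "br_VT_L scale D a (tens scale b c) = tens_right scale (br scale D a b) c"
    unfolding br_VT_L_def
    by (rule lin_ext_tens[OF vector_space_scale3]) (use B in \<open>simp add: defs algebra_simps\<close>)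
  show "br_VT_R scale D a (tens scale b c) = perm12 (tens_left scale b (br scale D a c))"
    unfolding br_VT_R_def
    by (rule lin_ext_tens[OF vector_space_scale3]) (use B in \<open>simp add: defs algebra_simps\<close>)
  show "br_TV_L scale D (tens scale a b) c = perm23 (tens_right scale (br scale D a c) b)"
    unfolding br_TV_L_def
    by (rule lin_ext_tens[OF vector_space_scale3]) (use B in \<open>simp add: defs algebra_simps\<close>)
  show "br_TV_R scale D (tens scale a b) c = tens_left scale a (br scale D b c)"
    unfolding br_TV_R_def
    by (rule lin_ext_tens[OF vector_space_scale3]) (use B in \<open>simp add: defs algebra_simps\<close>)
qed

lemma endo_trace_basis_independent:
  assumes x: "Vector_Spaces.linear scale scale x"
    and C: "independent C" "span C = UNIV"
  shows "endo_trace scale C x = endo_trace scale Basis x"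
proof -
  have finC: "finite C" using C finiteI_independent by blast
  interpret c: finite_dimensional_vector_space scale C
    by unfold_locales (use C finC in auto)
  have rep: "endo_trace scale Basis x = (\<Sum>b\<in>Basis. coord b (x b))"
    "endo_trace scale C x = (\<Sum>d\<in>C. c.coord d (x d))"
    by (simp_all add: endo_trace_def coord_def c.coord_def)
  have lf: "linear_between scale UNIV (*) UNIV (\<lambda>v. f (x v))" if "functional scale f" for f
    using x that by (auto simp: linear_between_def functional_add functional_scale
        linear.axioms module_hom.add[of scale scale x] module_hom.scale[of scale scale x]
        Vector_Spaces.linear_def)
  have "(\<Sum>b\<in>Basis. coord b (x b))
      = (\<Sum>b\<in>Basis. \<Sum>d\<in>C. c.coord d (x b) * coord b d)"
  proof (rule sum.cong[OF refl])
    fix b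
    have "linear_between scale UNIV (*) UNIV (coord b)"
      using functional_coord[of b] by (auto simp: linear_between_def functional_add functional_scale)
    from c.sum_coord_linear[OF vector_space_mult this, of "x b"]
    show "coord b (x b) = (\<Sum>d\<in>C. c.coord d (x b) * coord b d)" by simp
  qed
  also have "\<dots> = (\<Sum>d\<in>C. \<Sum>b\<in>Basis. coord b d * c.coord d (x b))"
    by (subst sum.swap) (simp add: mult.commute)
  also have "\<dots> = (\<Sum>d\<in>C. c.coord d (x d))"
    by (rule sum.cong[OF refl], rule sum_coord_linear[OF vector_space_mult lf[OF c.functional_coord]])
  finally show ?thesis using rep by simp
qed

end

end

theory Submission
  imports Defs
begin

text \<open>Write \<open>E(a, f)\<close> for the rank-one operator \<open>v \<mapsto> f(v) a\<close>. Pairing the bracket with functionals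
  gives \<open>(f \<otimes> g){{a, b}} = tr(R(E(a, f)) E(b, g))\<close>. Hence, with \<open>x = E(a, f)\<close>, \<open>y = E(b, g)\<close> and
  \<open>z = E(c, h)\<close>, each of the double brackets of \<open>a, b, c\<close>, paired with \<open>f \<otimes> g \<otimes> h\<close>, is the trace of a
  word in \<open>x, y, z, R, R\<^sup>*\<close>. Rank-one operators span \<open>End V\<close>, so an identity of double brackets amounts
  to an identity of such traces for all \<open>x, y, z\<close>; moving one of the variables to the end, by
  cyclicity and conjugation, turns it into an operator identity because the trace form is
  nondegenerate.\<close>

section \<open>Rank-one operators and the trace form\<close>

context finite_dimensional_vector_space
begin

abbreviation "EndV \<equiv> End_space scale"
abbreviation "tf \<equiv> trace_form scale Basis"

definition rank_one :: "'b \<Rightarrow> ('b \<Rightarrow> 'a) \<Rightarrow> 'b \<Rightarrow> 'b"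
  where "rank_one a f = (\<lambda>v. scale (f v) a)"

section \<open>Closure properties of endomorphisms and functionals\<close>

lemma End_space_iff:
  "x \<in> EndV \<longleftrightarrow> (\<forall>u v. x (u + v) = x u + x v) \<and> (\<forall>c v. x (scale c v) = scale c (x v))"
  unfolding End_space_def mem_Collect_eq
  using linear_iff vector_space_axioms by (auto simp: Vector_Spaces.linear_iff)

lemma functional_iff:
  "functional scale f \<longleftrightarrow> (\<forall>u v. f (u + v) = f u + f v) \<and> (\<forall>c v. f (scale c v) = c * f v)"
  unfolding functional_def
  using vector_space_axioms vector_space_mult by (auto simp: Vector_Spaces.linear_iff)

lemma End_add: "x \<in> EndV \<Longrightarrow> x (u + v) = x u + x v"
  and End_scale: "x \<in> EndV \<Longrightarrow> x (scale c v) = scale c (x v)"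
  by (simp_all add: End_space_iff)

lemma End_zero: "x \<in> EndV \<Longrightarrow> x 0 = 0"
  using End_scale[of x 0 0] by simp

lemma End_comp: "x \<in> EndV \<Longrightarrow> y \<in> EndV \<Longrightarrow> x \<circ> y \<in> EndV"
  and End_plus: "x \<in> EndV \<Longrightarrow> y \<in> EndV \<Longrightarrow> x + y \<in> EndV"
  and End_uminus: "x \<in> EndV \<Longrightarrow> - x \<in> EndV"
  and End_fun_scale: "x \<in> EndV \<Longrightarrow> fun_scale scale c x \<in> EndV"
  by (auto simp: End_space_iff fun_scale_def algebra_simps scale_right_distrib)

lemma End_comp_add_left: "(x + x') \<circ> y = (x \<circ> y) + (x' \<circ> y)"
  by (simp add: fun_eq_iff)

lemma End_comp_add_right: "x \<in> EndV \<Longrightarrow> x \<circ> (y + y') = (x \<circ> y) + (x \<circ> y')"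
  by (simp add: fun_eq_iff End_add)

lemma fun_scale_add: "fun_scale scale c (x + y) = fun_scale scale c x + fun_scale scale c y"
  by (simp add: fun_scale_def fun_eq_iff scale_right_distrib)

lemma functional_comp: "functional scale f \<Longrightarrow> x \<in> EndV \<Longrightarrow> functional scale (f \<circ> x)"
  by (simp add: functional_iff End_space_iff)

lemma rank_one_End: "functional scale f \<Longrightarrow> rank_one a f \<in> EndV"
  by (simp add: functional_iff End_space_iff rank_one_def scale_left_distrib)

lemma rank_one_comp: "rank_one a (f \<circ> x) = rank_one a f \<circ> x"
  by (simp add: rank_one_def fun_eq_iff)

section \<open>Decomposition into rank-one operators\<close>

lemma End_sum: "(\<And>i. i \<in> I \<Longrightarrow> x i \<in> EndV) \<Longrightarrow> (\<Sum>i\<in>I. x i) \<in> EndV"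
proof (induction I rule: infinite_finite_induct)
  case (insert i I)
  \<comment> \<open>The induction leaves the goal eta-expanded, so that \<open>plus_fun_apply\<close> would rewrite inside it.\<close>
  then show ?case by (simp add: End_plus del: plus_fun_apply)
qed (simp_all add: End_space_iff)

lemma sum_fun_apply: "(\<Sum>i\<in>I. x i) v = (\<Sum>i\<in>I. x i v)"
  by (induction I rule: infinite_finite_induct) auto

lemma End_sum_rank_one:
  assumes "x \<in> EndV"
  shows "x = (\<Sum>b\<in>Basis. rank_one (x b) (coord b))"
proof
  fix v
  have "linear_between scale UNIV scale UNIV x"
    using assms by (auto simp: linear_between_def End_space_iff)
  from sum_coord_linear[OF vector_space_axioms this, of v]
  show "x v = (\<Sum>b\<in>Basis. rank_one (x b) (coord b)) v"
    by (simp add: sum_fun_apply rank_one_def)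
qed

text \<open>Rests on \<open>End_sum_rank_one\<close>. No case for scalar multiples is needed,
  because the coefficients there are absorbed into the vectors \<open>x b\<close>.\<close>

lemma End_induct [consumes 1, case_names rank_one add]:
  assumes "x \<in> EndV"
    and rank_one: "\<And>a f. functional scale f \<Longrightarrow> P (rank_one a f)"
    and add: "\<And>x y. x \<in> EndV \<Longrightarrow> y \<in> EndV \<Longrightarrow> P x \<Longrightarrow> P y \<Longrightarrow> P (x + y)"
  shows "P x"
proof -
  \<comment> \<open>Zero is \<open>rank_one 0 f\<close> for any functional \<open>f\<close>;
    \<open>coord undefined\<close> is a functional whatever its index.\<close>
  have "P 0"
    using rank_one[OF functional_coord[of undefined], of 0] by (simp add: rank_one_def zero_fun_def)
  then have "P (\<Sum>b\<in>I. rank_one (x b) (coord b))" for I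
  proof (induction I rule: infinite_finite_induct)
    case (insert i I)
    then show ?case
      by (simp add: add rank_one rank_one_End End_sum functional_coord del: plus_fun_apply)
  qed (simp_all del: zero_fun_apply)
  then show ?thesis by (subst End_sum_rank_one[OF assms(1)])
qed

section \<open>The trace form\<close>

lemma tf_coord: "tf x y = (\<Sum>b\<in>Basis. coord b (x (y b)))"
  by (simp add: trace_form_def endo_trace_def coord_def)

lemma coord_add: "coord b (u + v) = coord b u + coord b v"
  and coord_scale: "coord b (scale c v) = c * coord b v"
  using functional_coord[of b] by (simp_all add: functional_iff)

lemma coord_zero: "coord b 0 = 0"
  using coord_scale[of b 0 0] by simp

lemma functional_sum_coord:
  assumes "functional scale f" shows "(\<Sum>b\<in>Basis. coord b v * f b) = f v"
  by (rule sum_coord_linear[OF vector_space_mult])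
    (use assms in \<open>auto simp: linear_between_def functional_iff\<close>)

text \<open>Expanding the inner vector in \<open>Basis\<close> turns both traces into the same
  double sum of products of matrix entries, up to the order of summation.\<close>

lemma tf_commute:
  assumes "x \<in> EndV" "y \<in> EndV" shows "tf x y = tf y x"
proof -
  have e: "tf u v = (\<Sum>b\<in>Basis. \<Sum>c\<in>Basis. coord c (v b) * coord b (u c))" if "u \<in> EndV" for u v
    unfolding tf_coord
    using functional_sum_coord[OF functional_comp[OF functional_coord that]] by simp
  show ?thesis
    unfolding e[OF assms(1)] e[OF assms(2)] by (subst sum.swap) (simp add: mult.commute)
qed

lemma tf_comp: "tf (x \<circ> y) z = tf x (y \<circ> z)"
  by (simp add: trace_form_def o_assoc)

lemma tf_add_left: "tf (x + x') y = tf x y + tf x' y"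
  by (simp add: tf_coord coord_add sum.distrib)

lemma tf_add_right: "x \<in> EndV \<Longrightarrow> tf x (y + y') = tf x y + tf x y'"
  by (simp add: tf_coord coord_add End_add sum.distrib)

lemma tf_scale_left: "tf (fun_scale scale c x) y = c * tf x y"
  by (simp add: tf_coord fun_scale_def coord_scale sum_distrib_left)

lemma tf_scale_right: "x \<in> EndV \<Longrightarrow> tf x (fun_scale scale c y) = c * tf x y"
  by (simp add: tf_coord fun_scale_def coord_scale End_scale sum_distrib_left)

lemma tf_uminus_left: "tf (- x) y = - tf x y"
proof -
  have "- x = fun_scale scale (- 1) x" by (simp add: fun_scale_def fun_eq_iff)
  then show ?thesis by (simp add: tf_scale_left)
qed

lemma tf_diff_left: "tf (x - x') y = tf x y - tf x' y"
  using tf_add_left[of x "- x'" y] by (simp add: tf_uminus_left)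

text \<open>The trace is the sum of \<open>coord b (x c) * h b\<close>, which is \<open>h\<close>
  applied to the coordinate expansion of \<open>x c\<close>. This translates evaluations of
  functionals into traces.\<close>

lemma tf_rank_one:
  assumes "functional scale h" "x \<in> EndV"
  shows "tf x (rank_one c h) = h (x c)"
  using functional_sum_coord[OF assms(1), of "x c"] assms(2)
  by (simp add: tf_coord rank_one_def End_scale coord_scale mult.commute)

text \<open>Pairing with \<open>rank_one v (coord b)\<close> reads off the coordinate of
  \<open>x v\<close> at \<open>b\<close>.\<close>

lemma tf_nondegenerate:
  assumes "x \<in> EndV" "y \<in> EndV" "\<And>z. z \<in> EndV \<Longrightarrow> tf x z = tf y z"
  shows "x = y"
proof
  fix v
  have "coord b (x v) = coord b (y v)" for b
    using assms(3)[OF rank_one_End[OF functional_coord], of v b] assms(1,2)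
    by (simp add: tf_rank_one functional_coord)
  then have "(\<Sum>b\<in>Basis. scale (coord b (x v)) b) = (\<Sum>b\<in>Basis. scale (coord b (y v)) b)"
    by (simp only:)
  then show "x v = y v" unfolding sum_coord .
qed

section \<open>Identities between trilinear forms\<close>

text \<open>Additivity suffices, since scalar multiples of rank-one operators have the same form.\<close>

definition triadditive :: "(('b \<Rightarrow> 'b) \<Rightarrow> ('b \<Rightarrow> 'b) \<Rightarrow> ('b \<Rightarrow> 'b) \<Rightarrow> 'a) \<Rightarrow> bool"
  where "triadditive F \<longleftrightarrow> (\<forall>x\<in>EndV. \<forall>y\<in>EndV. \<forall>z\<in>EndV. \<forall>w\<in>EndV.
    F (x + w) y z = F x y z + F w y z \<and> F x (y + w) z = F x y z + F x w z \<and>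
    F x y (z + w) = F x y z + F x y w)"

text \<open>The variables are freed one at a time by \<open>End_induct\<close>, the remaining ones
  staying of rank one.\<close>

lemma triadditive_eq_iff:
  assumes F: "triadditive F" and G: "triadditive G"
  shows "(\<forall>a b c f g h. functional scale f \<and> functional scale g \<and> functional scale h \<longrightarrow>
      F (rank_one a f) (rank_one b g) (rank_one c h) = G (rank_one a f) (rank_one b g) (rank_one c h))
    \<longleftrightarrow> (\<forall>x\<in>EndV. \<forall>y\<in>EndV. \<forall>z\<in>EndV. F x y z = G x y z)" (is "?L \<longleftrightarrow> ?R")
proof
  assume L: ?L
  have 1: "F x (rank_one b g) (rank_one c h) = G x (rank_one b g) (rank_one c h)"
    if "functional scale g" "functional scale h" "x \<in> EndV" for b c g h x
    using that(3)
  proof (induction x rule: End_induct)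
    case (rank_one a f)
    then show ?case using L that by blast
  next
    case (add x y)
    then show ?case using F G that by (simp add: triadditive_def rank_one_End del: plus_fun_apply)
  qed
  have 2: "F x y (rank_one c h) = G x y (rank_one c h)"
    if "functional scale h" "x \<in> EndV" "y \<in> EndV" for c h x y
    using that(3)
  proof (induction y rule: End_induct)
    case (rank_one a f)
    then show ?case using 1 that by blast
  next
    case (add x y)
    then show ?case using F G that by (simp add: triadditive_def rank_one_End del: plus_fun_apply)
  qed
  have "F x y z = G x y z" if "x \<in> EndV" "y \<in> EndV" "z \<in> EndV" for x y z
    using that(3)
  proof (induction z rule: End_induct)
    case (rank_one a f)
    then show ?case using 2 that by blast
  next
    case (add x y)
    then show ?case using F G that by (simp add: triadditive_def del: plus_fun_apply)
  qed
  then show ?R by blast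
qed (blast intro: rank_one_End)

lemma trilinear_form_eq_iff_operator_eq:
  assumes "\<And>x y. x \<in> EndV \<Longrightarrow> y \<in> EndV \<Longrightarrow> S x y \<in> EndV"
    and "\<And>x y. x \<in> EndV \<Longrightarrow> y \<in> EndV \<Longrightarrow> T x y \<in> EndV"
  shows "(\<forall>x\<in>EndV. \<forall>y\<in>EndV. \<forall>z\<in>EndV. tf (S x y) z = tf (T x y) z)
    \<longleftrightarrow> (\<forall>x\<in>EndV. \<forall>y\<in>EndV. S x y = T x y)"
  using assms tf_nondegenerate by metis

text \<open>Since \<open>e'\<close> spans, \<open>y\<close> has some coefficients in it; duality
  identifies them by pairing \<open>y\<close> with each \<open>e i\<close>.\<close>

lemma dual_End_basis_expansion:
  assumes e: "End_basis scale N e" and e': "dual_End_basis scale Basis N e e'" and y: "y \<in> EndV"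
  shows "y = (\<Sum>i=1..N. fun_scale scale (tf (e i) y) (e' i))"
proof -
  interpret F: vector_space "fun_scale scale"
    by (rule vector_space_fun_scale[OF vector_space_axioms])
  have inj: "inj_on e' {1..N}" and span: "F.span (e' ` {1..N}) = EndV"
    and d: "\<And>i j. i \<in> {1..N} \<Longrightarrow> j \<in> {1..N} \<Longrightarrow> tf (e i) (e' j) = (if i = j then 1 else 0)"
    using e' unfolding dual_End_basis_def End_basis_def by blast+
  have eE: "e i \<in> EndV" if "i \<in> {1..N}" for i
    using that e F.span_base[of "e i" "e ` {1..N}"] unfolding End_basis_def by blast
  have e'E: "e' i \<in> EndV" if "i \<in> {1..N}" for i
    using that span F.span_base[of "e' i" "e' ` {1..N}"] by blast
  have "y \<in> range (\<lambda>u. \<Sum>v\<in>e' ` {1..N}. fun_scale scale (u v) v)"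
    using y span F.span_finite[of "e' ` {1..N}"] by simp
  \<comment> \<open>The coefficients are indexed by vectors; injectivity of \<open>e'\<close> lets
    the sum run over indices instead.\<close>
  then obtain u where u: "y = (\<Sum>i=1..N. fun_scale scale (u (e' i)) (e' i))"
    using inj by (auto simp: sum.reindex)
  have sum: "tf x (\<Sum>i\<in>I. z i) = (\<Sum>i\<in>I. tf x (z i))" if "x \<in> EndV" for x and z :: "nat \<Rightarrow> _" and I
  proof (induction I rule: infinite_finite_induct)
    case (insert i I)
    then show ?case by (simp add: tf_add_right that del: plus_fun_apply)
  qed (simp_all add: tf_coord End_zero that coord_zero)
  have "tf (e i) y = u (e' i)" if i: "i \<in> {1..N}" for i
  proof -
    have "tf (e i) y = (\<Sum>j=1..N. u (e' j) * tf (e i) (e' j))"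
      by (subst u) (simp add: sum[OF eE[OF i]] tf_scale_right[OF eE[OF i]])
    also have "\<dots> = (\<Sum>j=1..N. if i = j then u (e' j) else 0)"
      using i by (intro sum.cong) (auto simp: d)
    finally show ?thesis using i by simp
  qed
  then show ?thesis using u by simp
qed

text \<open>The extension is chosen by \<open>SOME\<close>, so it is computed by guessing a linear
  \<open>H\<close> and comparing on pure tensors.\<close>

lemma lin_ext_eqI:
  assumes F: "bilinear_map scale scale3 F"
    and H: "linear_between scale2 (tensor_square scale) scale3 UNIV H"
    and eq: "\<And>a b. F a b = H (tens scale a b)" and u: "u \<in> tensor_square scale"
  shows "lin_ext scale scale3 F u = H u"
proof (rule tensor2_unique[OF vector_space_axioms vector_space_scale3 _ H _ u])
  show "linear_between scale2 (tensor_square scale) scale3 UNIV (lin_ext scale scale3 F)"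
    by (rule lin_ext_linear[OF vector_space_scale3 F])
  show "lin_ext scale scale3 F (tens scale a b) = H (tens scale a b)" for a b
    using lin_ext_tens[OF vector_space_scale3 F] eq by simp
qed

text \<open>Tensors vanish on arguments that are not functionals, but precomposing such an argument with an
  endomorphism can produce a functional, hence the guard.\<close>

definition guard3 :: "('a, 'b) tensor3 \<Rightarrow> ('a, 'b) tensor3"
  where "guard3 U = (\<lambda>f g h.
    if functional scale f \<and> functional scale g \<and> functional scale h then U f g h else 0)"

lemma guard3_cong:
  assumes "\<And>f g h. functional scale f \<Longrightarrow> functional scale g \<Longrightarrow> functional scale h \<Longrightarrow> U f g h = W f g h"
  shows "guard3 U = guard3 W"
  using assms by (auto simp: guard3_def fun_eq_iff)

lemma eq_guard3I:
  assumes "\<And>f g h. functional scale f \<Longrightarrow> functional scale g \<Longrightarrow> functional scale h \<Longrightarrow> U f g h = W f g h"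
    and "\<And>f g h. \<not> (functional scale f \<and> functional scale g \<and> functional scale h) \<Longrightarrow> U f g h = 0"
  shows "U = guard3 W"
  using assms by (auto simp: guard3_def fun_eq_iff)

lemma guard3_linear:
  assumes "\<And>u v f g h. U (u + v) f g h = U u f g h + U v f g h"
    and "\<And>c u f g h. U (scale2 c u) f g h = c * U u f g h"
  shows "linear_between scale2 (tensor_square scale) scale3 UNIV (\<lambda>u. guard3 (U u))"
  using assms
  by (auto simp: linear_between_def guard3_def scale3_def fun_scale_def fun_eq_iff)

end

section \<open>Brackets as traces\<close>

text \<open>The data of the theorem. \<open>R'\<close> stands for \<open>R\<^sup>*\<close>, and it
  is known only through \<open>conj\<close>.\<close>

locale bracket_operator = finite_dimensional_vector_space scale Basis
  for scale :: "'k::field \<Rightarrow> 'v::ab_group_add \<Rightarrow> 'v" and Basis :: "'v set" +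
  fixes D :: "('k, 'v) tensor2 \<Rightarrow> ('k, 'v) tensor2"
    and R R' :: "('v \<Rightarrow> 'v) \<Rightarrow> ('v \<Rightarrow> 'v)"
    and N :: nat and e e' :: "nat \<Rightarrow> 'v \<Rightarrow> 'v"
  assumes D: "double_bracket scale D"
    and R: "End_operator scale R"
    and e: "End_basis scale N e" and e': "dual_End_basis scale Basis N e e'"
    and bracket: "bracket_of_operator scale N e e' R D"
    and conj: "conjugate_operator scale Basis R R'"
begin

lemma R_End: "x \<in> EndV \<Longrightarrow> R x \<in> EndV"
  and R_add: "x \<in> EndV \<Longrightarrow> y \<in> EndV \<Longrightarrow> R (x + y) = R x + R y"
  and R_scale: "x \<in> EndV \<Longrightarrow> R (fun_scale scale c x) = fun_scale scale c (R x)"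
  using R by (auto simp: End_operator_def linear_between_def)

lemma R'_End: "x \<in> EndV \<Longrightarrow> R' x \<in> EndV"
  and R'_add: "x \<in> EndV \<Longrightarrow> y \<in> EndV \<Longrightarrow> R' (x + y) = R' x + R' y"
  and conj_tf: "x \<in> EndV \<Longrightarrow> y \<in> EndV \<Longrightarrow> tf (R x) y = tf x (R' y)"
  using conj by (auto simp: conjugate_operator_def End_operator_def linear_between_def)

lemmas closed = R_End R'_End End_comp End_plus End_uminus End_fun_scale rank_one_End functional_comp
lemmas additive = R_add R'_add End_comp_add_left End_comp_add_right tf_add_left tf_add_right

text \<open>By \<open>tf_rank_one\<close>, \<open>f (e i a)\<close> is the coefficient of
  \<open>rank_one a f\<close> at \<open>e' i\<close>, so the defining sum of the bracket collapses
  to \<open>g (R (rank_one a f) b)\<close>. The bases \<open>e\<close> and \<open>e'\<close>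
  disappear here.\<close>

lemma br_eval:
  "br scale D a b f g = (if functional scale f \<and> functional scale g
    then tf (R (rank_one a f)) (rank_one b g) else 0)"
proof (cases "functional scale f \<and> functional scale g")
  case False
  then show ?thesis
    using bracket by (auto simp: bracket_of_operator_def sum_fun_apply tens_def ev_def)
next
  case True
  interpret F: vector_space "fun_scale scale"
    by (rule vector_space_fun_scale[OF vector_space_axioms])
  have eE: "e i \<in> EndV" "e' i \<in> EndV" if "i \<in> {1..N}" for i
    using that e e' F.span_base[of "e i" "e ` {1..N}"] F.span_base[of "e' i" "e' ` {1..N}"]
    unfolding End_basis_def dual_End_basis_def by blast+
  define x where "x = rank_one a f"
  have x: "x \<in> EndV" using True by (simp add: x_def closed)
  have c: "f (e i a) = tf (e i) x" if "i \<in> {1..N}" for i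
    using True eE[OF that] by (simp add: x_def tf_rank_one)
  have R_sum: "R (\<Sum>i\<in>I. fun_scale scale (c i) (e' i)) = (\<Sum>i\<in>I. fun_scale scale (c i) (R (e' i)))"
    if "I \<subseteq> {1..N}" for c and I
    using finite_subset[OF that finite_atLeastAtMost] that
  proof (induction I rule: finite_induct)
    case empty
    \<comment> \<open>The empty sum requires \<open>R 0 = 0\<close>, obtained by scaling the
      endomorphism \<open>x\<close> by zero.\<close>
    have "fun_scale scale 0 y = 0" for y by (simp add: fun_scale_def fun_eq_iff)
    then show ?case using R_scale[OF x, of 0] by (simp del: zero_fun_apply)
  next
    case (insert i I)
    then have "(\<Sum>i\<in>I. fun_scale scale (c i) (e' i)) \<in> EndV"
      by (intro End_sum closed eE) auto
    with insert show ?case by (simp add: R_add R_scale closed eE del: plus_fun_apply)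
  qed
  have g_sum: "g (\<Sum>i\<in>I. u i) = (\<Sum>i\<in>I. g (u i))" for u :: "nat \<Rightarrow> 'v" and I
  proof (induction I rule: infinite_finite_induct)
    case (insert i I)
    then show ?case using True by (simp add: functional_add[of scale g])
  qed (use True functional_scale[of scale g 0 0] in simp_all)
  have "R x = (\<Sum>i=1..N. fun_scale scale (tf (e i) x) (R (e' i)))"
    using arg_cong[OF dual_End_basis_expansion[OF e e' x], of R] unfolding R_sum[OF order_refl] .
  then have "R x b = (\<Sum>i=1..N. scale (tf (e i) x) (R (e' i) b))"
    by (simp add: sum_fun_apply fun_scale_def)
  then have "tf (R x) (rank_one b g) = (\<Sum>i=1..N. tf (e i) x * g (R (e' i) b))"
    using True by (simp add: tf_rank_one closed x g_sum functional_scale[of scale g])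
  also have "\<dots> = (\<Sum>i=1..N. f (e i a) * g (R (e' i) b))"
    by (simp add: c)
  also have "\<dots> = br scale D a b f g"
    using bracket True by (simp add: bracket_of_operator_def sum_fun_apply tens_def ev_def)
  finally show ?thesis using True by (simp add: x_def)
qed

section \<open>Extended brackets as traces\<close>

lemma br_tensor_square: "br scale D a b \<in> tensor_square scale"
proof -
  interpret v2: vector_space "scale2 :: 'k \<Rightarrow> ('k, 'v) tensor2 \<Rightarrow> _" by (rule vector_space_scale2)
  have "tens scale a b \<in> tensor_square scale"
    unfolding tensor_square_def by (rule v2.span_base) auto
  then show ?thesis using D unfolding double_bracket_def linear_between_def br_def by blast
qed

text \<open>Conjugation moves the operator off \<open>rank_one a f\<close>, so that the bracket
  becomes an endomorphism applied to \<open>a\<close>. With \<open>br_eval_right\<close> this gives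
  two ways to absorb a bracket into a functional.\<close>

lemma br_eval_left: "functional scale f \<Longrightarrow> functional scale g \<Longrightarrow>
    br scale D a b f g = f (R' (rank_one b g) a)"
  using conj_tf[of "rank_one a f" "rank_one b g"] tf_commute[of "rank_one a f" "R' (rank_one b g)"]
  by (simp add: br_eval closed tf_rank_one[where x = "R' _"])

lemma br_eval_right: "functional scale f \<Longrightarrow> functional scale g \<Longrightarrow>
    br scale D a b f g = g (R (rank_one a f) b)"
  by (simp add: br_eval closed tf_rank_one)

lemma br_not_functional: "\<not> (functional scale f \<and> functional scale g) \<Longrightarrow> br scale D a b f g = 0"
  by (auto simp: br_eval)

text \<open>On \<open>tens scale b c\<close> the first bracket has the value
  \<open>g (R (rank_one a f) b) * h c\<close>, which is the same tensor evaluated at a precomposed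
  functional. That description is linear in \<open>u\<close>, hence valid on the whole tensor
  square. The other three are alike, with \<open>R'\<close> where the single vector is on the
  right.\<close>

lemma
  assumes u: "u \<in> tensor_square scale"
  shows br_VT_L_eval: "br_VT_L scale D a u = guard3 (\<lambda>f g h. u (g \<circ> R (rank_one a f)) h)"
    and br_VT_R_eval: "br_VT_R scale D a u = guard3 (\<lambda>f g h. u g (h \<circ> R (rank_one a f)))"
    and br_TV_L_eval: "br_TV_L scale D u c = guard3 (\<lambda>f g h. u (f \<circ> R' (rank_one c h)) g)"
    and br_TV_R_eval: "br_TV_R scale D u c = guard3 (\<lambda>f g h. u f (g \<circ> R' (rank_one c h)))"
proof -
  note B = bilinear_br[OF D]
  note defs = bilinear_map_def linear_between_def tens_right_def tens_left_def perm12_def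
    perm23_def scale2_def scale3_def fun_scale_def fun_eq_iff ev_add ev_scale
  note eval = tens_def tens_right_def tens_left_def perm12_def perm23_def ev_def closed
    functional_comp[unfolded comp_def] br_not_functional
  show "br_VT_L scale D a u = guard3 (\<lambda>f g h. u (g \<circ> R (rank_one a f)) h)"
    unfolding br_VT_L_def
    \<comment> \<open>The \<open>simp\<close> call proves bilinearity of the extended map;
      \<open>auto\<close> proves linearity in \<open>u\<close>, the values on pure tensors, and
      vanishing off functionals.\<close>
    by (rule lin_ext_eqI[OF _ guard3_linear eq_guard3I u])
      (use B in \<open>simp add: defs algebra_simps\<close>, auto simp: scale2_def fun_scale_def eval br_eval_right)
  show "br_VT_R scale D a u = guard3 (\<lambda>f g h. u g (h \<circ> R (rank_one a f)))"
    unfolding br_VT_R_def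
    by (rule lin_ext_eqI[OF _ guard3_linear eq_guard3I u])
      (use B in \<open>simp add: defs algebra_simps\<close>, auto simp: scale2_def fun_scale_def eval br_eval_right)
  show "br_TV_L scale D u c = guard3 (\<lambda>f g h. u (f \<circ> R' (rank_one c h)) g)"
    unfolding br_TV_L_def
    by (rule lin_ext_eqI[OF _ guard3_linear eq_guard3I u])
      (use B in \<open>simp add: defs algebra_simps\<close>, auto simp: scale2_def fun_scale_def eval br_eval_left)
  show "br_TV_R scale D u c = guard3 (\<lambda>f g h. u f (g \<circ> R' (rank_one c h)))"
    unfolding br_TV_R_def
    by (rule lin_ext_eqI[OF _ guard3_linear eq_guard3I u])
      (use B in \<open>simp add: defs algebra_simps\<close>, auto simp: scale2_def fun_scale_def eval br_eval_left)
qed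

text \<open>The outer bracket precomposes a functional with an endomorphism, and by
  \<open>rank_one_comp\<close> this becomes right multiplication of the rank-one operator fed to the
  inner bracket.\<close>

lemma
  shows br_VT_L_br: "br_VT_L scale D a (br scale D b c) =
      guard3 (\<lambda>f g h. tf (R (rank_one b g \<circ> R (rank_one a f))) (rank_one c h))" (is ?VL)
    and br_VT_R_br: "br_VT_R scale D a (br scale D b c) =
      guard3 (\<lambda>f g h. tf (R (rank_one a f) \<circ> R (rank_one b g)) (rank_one c h))" (is ?VR)
    and br_TV_L_br: "br_TV_L scale D (br scale D a b) c =
      guard3 (\<lambda>f g h. tf (R (rank_one a f \<circ> R' (rank_one c h))) (rank_one b g))" (is ?TL)
    and br_TV_R_br: "br_TV_R scale D (br scale D a b) c =
      guard3 (\<lambda>f g h. tf (R (rank_one a f)) (rank_one b g \<circ> R' (rank_one c h)))" (is ?TR)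
proof -
  note eval = br_tensor_square br_eval closed rank_one_comp
  show ?VL
    unfolding br_VT_L_eval[OF br_tensor_square] by (rule guard3_cong) (simp add: eval)
  show ?TL
    unfolding br_TV_L_eval[OF br_tensor_square] by (rule guard3_cong) (simp add: eval)
  show ?TR
    unfolding br_TV_R_eval[OF br_tensor_square] by (rule guard3_cong) (simp add: eval)
  show ?VR
    unfolding br_VT_R_eval[OF br_tensor_square]
  proof (rule guard3_cong)
    fix f g h
    assume *: "functional scale f" "functional scale g" "functional scale h"
    \<comment> \<open>Cyclicity isolates \<open>rank_one c h\<close> in the last place.\<close>
    have "tf (R (rank_one b g)) (rank_one c h \<circ> R (rank_one a f))
        = tf (R (rank_one a f)) (R (rank_one b g) \<circ> rank_one c h)"
      using * by (simp add: closed tf_commute[of "R (rank_one a f)"] tf_comp)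
    then show "br scale D b c g (h \<circ> R (rank_one a f))
        = tf (R (rank_one a f) \<circ> R (rank_one b g)) (rank_one c h)"
      using * by (simp add: eval tf_comp)
  qed
qed

section \<open>Identities of double brackets\<close>

text \<open>The factor \<open>k\<close> treats skew-symmetry and symmetry at once. The two sides of
  the bracket identity are the pairings of \<open>rank_one a f\<close> with
  \<open>R' (rank_one b g)\<close> and with \<open>k\<close> times \<open>R (rank_one b g)\<close>,
  so nondegeneracy applies.\<close>

lemma bracket_symmetry_iff:
  "(\<forall>a b. br scale D a b = scale2 k (swap2 (br scale D b a)))
    \<longleftrightarrow> (\<forall>x\<in>EndV. R' x = fun_scale scale k (R x))" (is "?L \<longleftrightarrow> ?R")
proof
  assume L: ?L
  have "R' x = fun_scale scale k (R x)" if "x \<in> EndV" for x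
    using that
  proof (induction x rule: End_induct)
    case (rank_one b g)
    note g = this
    have "tf (R' (rank_one b g)) z = tf (fun_scale scale k (R (rank_one b g))) z" if "z \<in> EndV" for z
      using that
    proof (induction z rule: End_induct)
      case (rank_one a f)
      have "br scale D a b f g = k * br scale D b a g f"
        by (subst L[rule_format]) (simp add: scale2_def fun_scale_def swap2_def)
      then show ?case
        using g rank_one
        by (simp add: br_eval conj_tf closed tf_scale_left tf_commute[of "rank_one a f"])
    qed (use g in \<open>simp add: closed additive del: plus_fun_apply\<close>)
    then show ?case by (intro tf_nondegenerate closed g)
  next
    case (add x y)
    then show ?case by (simp add: R_add R'_add fun_scale_add del: plus_fun_apply)
  qed
  then show ?R by blast
next
  assume R: ?R
  have eq: "br scale D a b f g = k * br scale D b a g f" for a b f g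
  proof (cases "functional scale f \<and> functional scale g")
    case True
    then have "R' (rank_one b g) a = scale k (R (rank_one b g) a)"
      using R by (simp add: closed fun_scale_def)
    then show ?thesis
      using True by (simp add: br_eval_left[of f g] br_eval_right[of g f] functional_scale[of scale f])
  next
    case False
    then show ?thesis using br_not_functional[of f g] br_not_functional[of g f] by auto
  qed
  show ?L
    unfolding scale2_def fun_scale_def swap2_def by (intro allI ext eq)
qed

lemma skew_iff:
  "(\<forall>a b. br scale D a b = - swap2 (br scale D b a)) \<longleftrightarrow> (\<forall>x\<in>EndV. R' x = - R x)"
proof -
  have "scale2 (- 1) u = - u" for u :: "('k, 'v) tensor2"
    by (simp add: scale2_def fun_scale_def fun_eq_iff)
  moreover have "fun_scale scale (- 1) x = - x" for x :: "'v \<Rightarrow> 'v"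
    by (simp add: fun_scale_def fun_eq_iff)
  ultimately show ?thesis using bracket_symmetry_iff[of "- 1"] by simp
qed

lemma symmetric_iff:
  "(\<forall>a b. br scale D a b = swap2 (br scale D b a)) \<longleftrightarrow> (\<forall>x\<in>EndV. R x = R' x)"
proof -
  have "scale2 1 u = u" for u :: "('k, 'v) tensor2"
    by (simp add: scale2_def fun_scale_def fun_eq_iff)
  moreover have "fun_scale scale 1 x = x" for x :: "'v \<Rightarrow> 'v"
    by (simp add: fun_scale_def fun_eq_iff)
  ultimately show ?thesis using bracket_symmetry_iff[of 1] by auto
qed

text \<open>Under the guard, equality of tensors is equality on functionals, which
  \<open>triadditive_eq_iff\<close> carries over to all endomorphisms.\<close>

lemma guard3_eq_iff:
  assumes "triadditive F" "triadditive G"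
  shows "(\<forall>a b c. guard3 (\<lambda>f g h. F (rank_one a f) (rank_one b g) (rank_one c h)) =
      guard3 (\<lambda>f g h. G (rank_one a f) (rank_one b g) (rank_one c h)))
    \<longleftrightarrow> (\<forall>x\<in>EndV. \<forall>y\<in>EndV. \<forall>z\<in>EndV. F x y z = G x y z)"
proof -
  have "(if P then p else 0) = (if P then q else 0) \<longleftrightarrow> (P \<longrightarrow> p = q)" for P and p q :: 'k
    by simp
  then show ?thesis
    unfolding triadditive_eq_iff[OF assms, symmetric] guard3_def fun_eq_iff by simp
qed

section \<open>Associativity and the Jacobi identity\<close>

lemma assoc_L_trace_iff:
  "(\<forall>a b c. br_VT_L scale D a (br scale D b c) = br_TV_L scale D (br scale D a b) c) \<longleftrightarrow>
    (\<forall>x\<in>EndV. \<forall>y\<in>EndV. \<forall>z\<in>EndV. tf (R (y \<circ> R x)) z = tf (R (x \<circ> R' z)) y)"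
  unfolding br_VT_L_br br_TV_L_br
  by (rule guard3_eq_iff) (simp_all add: triadditive_def closed additive)

lemma assoc_L_iff:
  "(\<forall>a b c. br_VT_L scale D a (br scale D b c) = br_TV_L scale D (br scale D a b) c) \<longleftrightarrow>
    (\<forall>x\<in>EndV. \<forall>y\<in>EndV. R' x \<circ> R' y = R' (R' x \<circ> y))"
proof -
  \<comment> \<open>Here \<open>x\<close> is the variable moved to the end; this leaves an identity
    for \<open>R'\<close> alone, in \<open>z\<close> and \<open>y\<close>.\<close>
  have "tf (R (y \<circ> R x)) z = tf (R' (R' z \<circ> y)) x" "tf (R (x \<circ> R' z)) y = tf (R' z \<circ> R' y) x"
    if "x \<in> EndV" "y \<in> EndV" "z \<in> EndV" for x y z
  proof -
    have "tf (R (y \<circ> R x)) z = tf (R' z) (y \<circ> R x)"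
      using that by (simp add: conj_tf closed tf_commute[of _ "R' z"])
    also have "\<dots> = tf (R x) (R' z \<circ> y)"
      using that tf_commute[of "R x" "R' z \<circ> y"] by (simp add: closed tf_comp)
    finally show "tf (R (y \<circ> R x)) z = tf (R' (R' z \<circ> y)) x"
      using that by (simp add: conj_tf closed tf_commute[of x])
    show "tf (R (x \<circ> R' z)) y = tf (R' z \<circ> R' y) x"
      using that tf_commute[of x "R' z \<circ> R' y"] by (simp add: conj_tf closed tf_comp)
  qed
  then have "(\<forall>a b c. br_VT_L scale D a (br scale D b c) = br_TV_L scale D (br scale D a b) c) \<longleftrightarrow>
    (\<forall>z\<in>EndV. \<forall>y\<in>EndV. \<forall>x\<in>EndV. tf (R' z \<circ> R' y) x = tf (R' (R' z \<circ> y)) x)"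
    unfolding assoc_L_trace_iff by metis
  also have "\<dots> \<longleftrightarrow> (\<forall>z\<in>EndV. \<forall>y\<in>EndV. R' z \<circ> R' y = R' (R' z \<circ> y))"
    by (rule trilinear_form_eq_iff_operator_eq) (simp_all add: closed)
  finally show ?thesis .
qed

text \<open>Both sides are the trace of \<open>x \<circ> R' z \<circ> R' y\<close>. The right one
  has \<open>z\<close> free of operators, as the comparison with \<open>R (y \<circ> R x)\<close>
  requires.\<close>

lemma tf_R_comp_R':
  assumes "x \<in> EndV" "y \<in> EndV" "z \<in> EndV"
  shows "tf (R (x \<circ> R' z)) y = tf (R (R' y \<circ> x)) z"
proof -
  have "tf (R (x \<circ> R' z)) y = tf (R' y) (x \<circ> R' z)"
    using assms by (simp add: conj_tf closed tf_commute[of _ "R' y"])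
  also have "\<dots> = tf (R (R' y \<circ> x)) z"
    using assms by (simp add: conj_tf closed tf_comp)
  finally show ?thesis .
qed

text \<open>Isolating \<open>z\<close> instead of \<open>x\<close> gives a second form of left
  associativity, suited to the commutative case.\<close>

lemma assoc_L_iff_R:
  "(\<forall>a b c. br_VT_L scale D a (br scale D b c) = br_TV_L scale D (br scale D a b) c) \<longleftrightarrow>
    (\<forall>x\<in>EndV. \<forall>y\<in>EndV. R (y \<circ> R x) = R (R' y \<circ> x))"
proof -
  have "(\<forall>x\<in>EndV. \<forall>y\<in>EndV. \<forall>z\<in>EndV. tf (R (y \<circ> R x)) z = tf (R (R' y \<circ> x)) z)
    \<longleftrightarrow> (\<forall>x\<in>EndV. \<forall>y\<in>EndV. R (y \<circ> R x) = R (R' y \<circ> x))"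
    by (rule trilinear_form_eq_iff_operator_eq) (simp_all add: closed)
  then show ?thesis unfolding assoc_L_trace_iff by (simp add: tf_R_comp_R')
qed

lemma assoc_R_iff:
  "(\<forall>a b c. br_VT_R scale D a (br scale D b c) = br_TV_R scale D (br scale D a b) c) \<longleftrightarrow>
    (\<forall>x\<in>EndV. \<forall>y\<in>EndV. R x \<circ> R y = R (R x \<circ> y))"
proof -
  \<comment> \<open>The variable \<open>z\<close> is already last; only the conjugate on it has to
    be moved.\<close>
  have eq: "tf (R x) (y \<circ> R' z) = tf (R (R x \<circ> y)) z"
    if "x \<in> EndV" "y \<in> EndV" "z \<in> EndV" for x y z
    using that by (simp add: conj_tf closed tf_comp)
  have "(\<forall>a b c. br_VT_R scale D a (br scale D b c) = br_TV_R scale D (br scale D a b) c) \<longleftrightarrow>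
    (\<forall>x\<in>EndV. \<forall>y\<in>EndV. \<forall>z\<in>EndV. tf (R x \<circ> R y) z = tf (R x) (y \<circ> R' z))"
    unfolding br_VT_R_br br_TV_R_br
    by (rule guard3_eq_iff) (simp_all add: triadditive_def closed additive)
  also have "\<dots> \<longleftrightarrow> (\<forall>x\<in>EndV. \<forall>y\<in>EndV. \<forall>z\<in>EndV. tf (R x \<circ> R y) z = tf (R (R x \<circ> y)) z)"
    by (simp add: eq)
  also have "\<dots> \<longleftrightarrow> (\<forall>x\<in>EndV. \<forall>y\<in>EndV. R x \<circ> R y = R (R x \<circ> y))"
    by (rule trilinear_form_eq_iff_operator_eq) (simp_all add: closed)
  finally show ?thesis .
qed

lemma jacobi_iff:
  "(\<forall>a b c. br_VT_L scale D a (br scale D b c) - perm12 (br_VT_R scale D b (br scale D a c))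
      = br_TV_L scale D (br scale D a b) c) \<longleftrightarrow>
    (\<forall>x\<in>EndV. \<forall>y\<in>EndV. R (y \<circ> R x) - (R y \<circ> R x) = R (R' y \<circ> x))"
proof -
  \<comment> \<open>In the subtracted term \<open>a\<close> and \<open>b\<close> are exchanged, and
    \<open>perm12\<close> exchanges \<open>f\<close> and \<open>g\<close>. So the pairs stay matched
    and only the order of the factors \<open>R y\<close> and \<open>R x\<close> is reversed.\<close>
  have "br_VT_L scale D a (br scale D b c) - perm12 (br_VT_R scale D b (br scale D a c)) =
    guard3 (\<lambda>f g h. (\<lambda>x y z. tf (R (y \<circ> R x)) z - tf (R y \<circ> R x) z)
      (rank_one a f) (rank_one b g) (rank_one c h))" for a b c
    unfolding br_VT_L_br br_VT_R_br by (simp add: fun_eq_iff guard3_def perm12_def)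
  then have "(\<forall>a b c. br_VT_L scale D a (br scale D b c) - perm12 (br_VT_R scale D b (br scale D a c))
      = br_TV_L scale D (br scale D a b) c) \<longleftrightarrow>
    (\<forall>x\<in>EndV. \<forall>y\<in>EndV. \<forall>z\<in>EndV.
      (\<lambda>x y z. tf (R (y \<circ> R x)) z - tf (R y \<circ> R x) z) x y z = tf (R (x \<circ> R' z)) y)"
    unfolding br_TV_L_br
    by (simp only:) (rule guard3_eq_iff, simp_all add: triadditive_def closed additive)
  also have "\<dots> \<longleftrightarrow> (\<forall>x\<in>EndV. \<forall>y\<in>EndV. \<forall>z\<in>EndV.
      tf (R (y \<circ> R x) - (R y \<circ> R x)) z = tf (R (R' y \<circ> x)) z)"
    by (simp add: tf_R_comp_R' tf_diff_left)
  also have "\<dots> \<longleftrightarrow> (\<forall>x\<in>EndV. \<forall>y\<in>EndV. R (y \<circ> R x) - (R y \<circ> R x) = R (R' y \<circ> x))"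
    by (rule trilinear_form_eq_iff_operator_eq)
      (simp_all add: closed diff_conv_add_uminus del: add_uminus_conv_diff)
  finally show ?thesis .
qed

section \<open>Characterizations of the three classes of double algebras\<close>

lemma R_uminus: "x \<in> EndV \<Longrightarrow> R (- x) = - R x"
proof -
  have "fun_scale scale (- 1) y = - y" for y :: "'v \<Rightarrow> 'v"
    by (simp add: fun_scale_def fun_eq_iff)
  then show "x \<in> EndV \<Longrightarrow> R (- x) = - R x" using R_scale[of x "- 1"] by simp
qed

text \<open>Skew-symmetry replaces \<open>R' y\<close> by \<open>- R y\<close> in
  \<open>jacobi_iff\<close>; rearranged, with \<open>x\<close> and \<open>y\<close> interchanged,
  this is the Rota-Baxter identity of weight zero.\<close>

lemma lie_iff:
  "lie_double_algebra scale D \<longleftrightarrow> (\<forall>x\<in>EndV. R' x = - R x) \<and>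
    (\<forall>x\<in>EndV. \<forall>y\<in>EndV. R x \<circ> R y = R (R x \<circ> y) + R (x \<circ> R y))"
proof -
  have "R (y \<circ> R x) - (R y \<circ> R x) = R (R' y \<circ> x) \<longleftrightarrow> R y \<circ> R x = R (R y \<circ> x) + R (y \<circ> R x)"
    if "R' y = - R y" "x \<in> EndV" "y \<in> EndV" for x y
  proof -
    have "R' y \<circ> x = - (R y \<circ> x)"
      by (simp add: that fun_eq_iff)
    then have "R (R' y \<circ> x) = - R (R y \<circ> x)"
      using that by (simp only: R_uminus closed)
    then show ?thesis by (auto simp: algebra_simps)
  qed
  then show ?thesis
    unfolding lie_double_algebra_def skew_iff jacobi_iff using D by blast
qed

lemma assoc_iff:
  "assoc_double_algebra scale D \<longleftrightarrow>
    (\<forall>x\<in>EndV. \<forall>y\<in>EndV. R x \<circ> R y = R (R x \<circ> y)) \<and>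
    (\<forall>x\<in>EndV. \<forall>y\<in>EndV. R' x \<circ> R' y = R' (R' x \<circ> y))"
  unfolding assoc_double_algebra_def assoc_L_iff assoc_R_iff using D by blast

text \<open>Once \<open>R' = R\<close>, \<open>assoc_L_iff_R\<close> says
  \<open>R (y \<circ> R x) = R (R y \<circ> x)\<close>, which is the second equality up to renaming;
  right associativity gives the first.\<close>

lemma comm_iff:
  "comm_double_algebra scale D \<longleftrightarrow> (\<forall>x\<in>EndV. R x = R' x) \<and>
    (\<forall>x\<in>EndV. \<forall>y\<in>EndV. R x \<circ> R y = R (R x \<circ> y) \<and> R (R x \<circ> y) = R (x \<circ> R y))"
  unfolding comm_double_algebra_def symmetric_iff assoc_double_algebra_def assoc_R_iff assoc_L_iff_R
  using D by auto

end

theorem theorem1: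
  fixes s :: "'k::field \<Rightarrow> 'v::ab_group_add \<Rightarrow> 'v" and B :: "'v set"
    and D :: "('k, 'v) tensor2 \<Rightarrow> ('k, 'v) tensor2"
    and R R' :: "('v \<Rightarrow> 'v) \<Rightarrow> ('v \<Rightarrow> 'v)"
    and N :: nat and e e' :: "nat \<Rightarrow> 'v \<Rightarrow> 'v"
  assumes "finite_dimensional_vector_space s B"
    and "double_bracket s D"
    and "End_operator s R"
    and "End_basis s N e" and "dual_End_basis s B N e e'"
    and "bracket_of_operator s N e e' R D"
    and "conjugate_operator s B R R'"
  shows "(lie_double_algebra s D \<longleftrightarrow>
      (\<forall>x\<in>End_space s. R' x = - R x) \<and>
      (\<forall>x\<in>End_space s. \<forall>y\<in>End_space s. R x \<circ> R y = R (R x \<circ> y) + R (x \<circ> R y)))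
    \<and> (assoc_double_algebra s D \<longleftrightarrow>
      (\<forall>x\<in>End_space s. \<forall>y\<in>End_space s. R x \<circ> R y = R (R x \<circ> y)) \<and>
      (\<forall>x\<in>End_space s. \<forall>y\<in>End_space s. R' x \<circ> R' y = R' (R' x \<circ> y)))
    \<and> (comm_double_algebra s D \<longleftrightarrow>
      (\<forall>x\<in>End_space s. R x = R' x) \<and>
      (\<forall>x\<in>End_space s. \<forall>y\<in>End_space s.
        R x \<circ> R y = R (R x \<circ> y) \<and> R (R x \<circ> y) = R (x \<circ> R y)))"
proof -
  interpret bracket_operator s B D R R' N e e'
    using assms by (simp add: bracket_operator_def bracket_operator_axioms_def)
  show ?thesis using lie_iff assoc_iff comm_iff by blast
qed

end
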